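(* Let $n\geq 2$ be an integer and let $LG_n = P_2 \,\square\, P_n$ be the Ladder graph on $2n$ vertices. Then $$\gamma_{SR}(LG_n) = \left\lfloor \frac{n+2}{2} \right\rfloor + 1.$$
   Context: All graphs are finite, simple and undirected. For a vertex $u$ of a graph $G$, $N_G[u]$ denotes the closed neighbourhood of $u$ (the vertex $u$ together with all vertices adjacent to $u$). A signed Roman dominating function (SRDF) on $G$ is a function $f: V(G)\to\{-1,1,2\}$ such that (i) $\sum_{v\in N_G[u]} f(v)\geq 1$ for every $u\in V(G)$, and (ii) every vertex $u$ with $f(u)=-1$ is adjacent to at least one vertex $v$ with $f(v)=2$. The weight of $f$ is $w(f)=\sum_{u\in V(G)} f(u)$, and the signed Roman domination number $\gamma_{SR}(G)$ is the minimum weight of an SRDF on $G$. $P_n$ denotes the path on $n$ vertices and $\square$ the Cartesian product of graphs. Concretely, $LG_n$ has vertex set $\{(1,i),(2,i): 1\le i\le n\}$ and edges $\{(1,i),(2,i)\}$ for $1\le i\le n$, and $\{(1,i),(1,i+1)\}$, $\{(2,i),(2,i+1)\}$ for $1\le i\le n-1$. *)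

theory Defs
  imports Complex_Main "HOL-Library.FuncSet" "Graph_Theory.Pair_Digraph"
begin

text \<open>
  Finite simple undirected graphs are the instances of the locale \<^locale>\<open>pair_graph\<close>: an
  undirected edge between \<open>u\<close> and \<open>v\<close> is the pair of opposite arcs \<open>(u, v)\<close> and \<open>(v, u)\<close>.
\<close>

definition closed_neighbourhood :: "'a pair_pre_digraph \<Rightarrow> 'a \<Rightarrow> 'a set" where
  "closed_neighbourhood G u = insert u {v \<in> pverts G. (u, v) \<in> parcs G}"

text \<open>
  Functions on the vertex set are represented by functions on the whole vertex type, whose values
  outside the vertex set are irrelevant.
\<close>

definition SRDF :: "'a pair_pre_digraph \<Rightarrow> ('a \<Rightarrow> int) \<Rightarrow> bool" where
  "SRDF G f \<longleftrightarrow>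
     (\<forall>u \<in> pverts G. f u \<in> {-1, 1, 2}) \<and>
     (\<forall>u \<in> pverts G. (\<Sum>v \<in> closed_neighbourhood G u. f v) \<ge> 1) \<and>
     (\<forall>u \<in> pverts G. f u = -1 \<longrightarrow> (\<exists>v \<in> pverts G. (u, v) \<in> parcs G \<and> f v = 2))"

definition weight :: "'a pair_pre_digraph \<Rightarrow> ('a \<Rightarrow> int) \<Rightarrow> int" where
  "weight G f = (\<Sum>u \<in> pverts G. f u)"

definition signed_Roman_domination_number :: "'a pair_pre_digraph \<Rightarrow> int" where
  "signed_Roman_domination_number G = Min (weight G ` {f. SRDF G f})"

definition path_graph :: "nat \<Rightarrow> nat pair_pre_digraph" where
  "path_graph n =
     \<lparr> pverts = {1..n},
       parcs = {(i, j). i \<in> {1..n} \<and> j \<in> {1..n} \<and> (j = i + 1 \<or> i = j + 1)} \<rparr>"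

definition cartesian_product ::
  "'a pair_pre_digraph \<Rightarrow> 'b pair_pre_digraph \<Rightarrow> ('a \<times> 'b) pair_pre_digraph" where
  "cartesian_product G H =
     \<lparr> pverts = pverts G \<times> pverts H,
       parcs = {((a, b), (c, d)).
         a \<in> pverts G \<and> c \<in> pverts G \<and> b \<in> pverts H \<and> d \<in> pverts H \<and>
         (a = c \<and> (b, d) \<in> parcs H \<or> b = d \<and> (a, c) \<in> parcs G)} \<rparr>"

definition ladder_graph :: "nat \<Rightarrow> (nat \<times> nat) pair_pre_digraph" where
  "ladder_graph n = cartesian_product (path_graph 2) (path_graph n)"

lemma pair_graph_path_graph: "pair_graph (path_graph n)"
proof
  show "finite (parcs (path_graph n))"
    by (rule finite_subset[of _ "{1..n} \<times> {1..n}"]) (auto simp: path_graph_def)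
qed (auto simp: path_graph_def symmetric_def sym_def)

lemma pair_graph_cartesian_product:
  assumes "pair_graph G" "pair_graph H"
  shows "pair_graph (cartesian_product G H)"
proof -
  interpret G: pair_graph G by fact
  interpret H: pair_graph H by fact
  have "sym (parcs G)" "sym (parcs H)"
    using G.pair_sym_arcs H.pair_sym_arcs by (auto simp: symmetric_def)
  show ?thesis
  proof
    show fin: "finite (pverts (cartesian_product G H))"
      using G.pair_finite_verts H.pair_finite_verts by (simp add: cartesian_product_def)
    show "finite (parcs (cartesian_product G H))"
      by (rule finite_subset[OF _ finite_cartesian_product[OF fin fin]])
        (auto simp: cartesian_product_def)
    show "symmetric (with_proj (cartesian_product G H))"
      using \<open>sym (parcs G)\<close> \<open>sym (parcs H)\<close>
      by (auto simp: cartesian_product_def symmetric_def sym_def)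
  next
    fix e assume "e \<in> parcs (cartesian_product G H)"
    then show "fst e \<noteq> snd e"
      using G.pair_no_loops H.pair_no_loops by (fastforce simp: cartesian_product_def)
  qed (auto simp: cartesian_product_def)
qed

lemma pair_graph_ladder_graph: "pair_graph (ladder_graph n)"
  unfolding ladder_graph_def
  by (intro pair_graph_cartesian_product pair_graph_path_graph)

lemma pverts_ladder_graph: "pverts (ladder_graph n) = {1, 2} \<times> {1..n}"
  by (auto simp: ladder_graph_def cartesian_product_def path_graph_def)

lemma parcs_ladder_graph:
  "parcs (ladder_graph n) =
     (let A = {((1, i), (2, i)) | i. 1 \<le> i \<and> i \<le> n} \<union>
              {((1, i), (1, i + 1)) | i. 1 \<le> i \<and> i \<le> n - 1} \<union>
              {((2, i), (2, i + 1)) | i. 1 \<le> i \<and> i \<le> n - 1}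
      in A \<union> A\<inverse>)"
proof -
  have two: "a \<in> {1..2} \<longleftrightarrow> a = 1 \<or> a = 2" for a :: nat
    by auto
  show ?thesis
    unfolding Let_def ladder_graph_def cartesian_product_def path_graph_def pair_pre_digraph.simps two
    by (rule set_eqI) auto
qed

text \<open>
  The minimum in the definition of the signed Roman domination number is taken over a finite
  nonempty set.
\<close>

lemma finite_weights_SRDF:
  assumes "pair_graph G"
  shows "finite (weight G ` {f. SRDF G f})"
proof (rule finite_subset)
  interpret pair_graph G by fact
  have "finite (pverts G)" by (rule pair_finite_verts)
  show "weight G ` {f. SRDF G f} \<subseteq> weight G ` (pverts G \<rightarrow>\<^sub>E {-1, 1, 2})"
  proof
    fix w assume "w \<in> weight G ` {f. SRDF G f}"
    then obtain f where f: "SRDF G f" "w = weight G f" by auto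
    have "restrict f (pverts G) \<in> pverts G \<rightarrow>\<^sub>E {-1, 1, 2}"
      using f(1) by (auto simp: SRDF_def)
    moreover have "w = weight G (restrict f (pverts G))"
      unfolding f(2) weight_def by (rule sum.cong) auto
    ultimately show "w \<in> weight G ` (pverts G \<rightarrow>\<^sub>E {-1, 1, 2})" by blast
  qed
  show "finite (weight G ` (pverts G \<rightarrow>\<^sub>E {-1, 1, 2}))"
    using \<open>finite (pverts G)\<close> by (intro finite_imageI finite_PiE) auto
qed

lemma SRDF_const_1:
  assumes "pair_graph G"
  shows "SRDF G (\<lambda>_. 1)"
proof -
  interpret pair_graph G by fact
  have "finite (closed_neighbourhood G u)" for u
    using pair_finite_verts by (simp add: closed_neighbourhood_def)
  moreover have "closed_neighbourhood G u \<noteq> {}" for u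
    by (simp add: closed_neighbourhood_def)
  ultimately have "card (closed_neighbourhood G u) \<ge> 1" for u
    by (simp add: Suc_le_eq card_gt_0_iff)
  then have "1 \<le> int (card (closed_neighbourhood G u))" for u
    by (metis of_nat_1 of_nat_mono)
  then show ?thesis by (simp add: SRDF_def)
qed

end

theory Submission
  imports Defs
begin

text \<open>
  Reading the ladder column by column, the weight of the first \<open>k\<close> columns of a signed Roman
  dominating function is bounded below by a potential that depends only on the last two of these
  columns. The conditions on a column make this bound pass from \<open>k\<close> to \<open>k + 1\<close>, and the condition
  on the last column forces the potential to be at least 3 there, so twice the total weight is at
  least \<open>n + 3\<close>. The bound is attained by alternating columns \<open>(-1, -1)\<close> at odd positions with
  columns \<open>(2, 1)\<close>, \<open>(1, 2)\<close> at even positions, where one entry of the first column, and of the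
  last column if \<open>n\<close> is odd, is raised from \<open>-1\<close> to \<open>1\<close>.
\<close>

section \<open>Signed Roman dominating functions on ladders\<close>

text \<open>Padding by 0 gives end columns the same formulas as inner ones: a missing neighbour adds
  nothing to a sum and is never a defending 2.\<close>

definition row :: "nat \<Rightarrow> (nat \<times> nat \<Rightarrow> int) \<Rightarrow> nat \<Rightarrow> nat \<Rightarrow> int" where
  "row n f r i = (if i \<in> {1..n} then f (r, i) else 0)"

text \<open>
  Here \<open>c\<close> is the value of a vertex, \<open>d\<close> that of the other vertex of its column, and \<open>p\<close>, \<open>q\<close>
  those of its neighbours in the same row, or 0 at an end of the ladder.
\<close>

definition dominated :: "int \<Rightarrow> int \<Rightarrow> int \<Rightarrow> int \<Rightarrow> bool" where
  "dominated p c d q \<longleftrightarrow> p + c + d + q \<ge> 1 \<and> (c = -1 \<longrightarrow> 2 \<in> {p, d, q})"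

lemma arc_ladder_graph_iff:
  assumes "r \<in> {1, 2}" "i \<in> {1..n}"
  shows "((r, i), v) \<in> parcs (ladder_graph n) \<longleftrightarrow>
    v \<in> {(3 - r, i), (r, i - 1), (r, i + 1)} \<and> v \<in> pverts (ladder_graph n)"
  using assms
  by (cases v) (auto simp: ladder_graph_def cartesian_product_def path_graph_def)

lemma sum_closed_neighbourhood_ladder_graph:
  assumes r: "r \<in> {1, 2}" and i: "i \<in> {1..n}"
  shows "(\<Sum>v \<in> closed_neighbourhood (ladder_graph n) (r, i). f v) =
    row n f r (i - 1) + row n f r i + row n f (3 - r) i + row n f r (i + 1)"
proof -
  let ?g = "\<lambda>(s, j). row n f s j"
  have "(\<Sum>v \<in> closed_neighbourhood (ladder_graph n) (r, i). f v) =
      (\<Sum>v \<in> {(r, i - 1), (r, i), (3 - r, i), (r, i + 1)}. ?g v)"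
  proof (rule sum.mono_neutral_cong_left)
    show "closed_neighbourhood (ladder_graph n) (r, i) \<subseteq>
        {(r, i - 1), (r, i), (3 - r, i), (r, i + 1)}"
      unfolding closed_neighbourhood_def arc_ladder_graph_iff[OF r i] by auto
    show "\<forall>v \<in> {(r, i - 1), (r, i), (3 - r, i), (r, i + 1)} -
        closed_neighbourhood (ladder_graph n) (r, i). ?g v = 0"
      using r i unfolding closed_neighbourhood_def arc_ladder_graph_iff[OF r i]
      by (auto simp: row_def pverts_ladder_graph split: if_splits)
    show "f v = ?g v" if "v \<in> closed_neighbourhood (ladder_graph n) (r, i)" for v
      using that i unfolding closed_neighbourhood_def
      by (auto simp: row_def pverts_ladder_graph)
  qed simp
  also have "\<dots> = row n f r (i - 1) + row n f r i + row n f (3 - r) i + row n f r (i + 1)"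
  proof -
    \<comment> \<open>Since \<open>i\<close> is positive, the truncated \<open>i - 1\<close> differs
      from \<open>i\<close>, so the four vertices are distinct and the sum splits.\<close>
    obtain j where "i = Suc j" using i by (cases i) auto
    then show ?thesis using r by auto
  qed
  finally show ?thesis .
qed

lemma SRDF_ladder_graph_iff:
  "SRDF (ladder_graph n) f \<longleftrightarrow>
    (\<forall>r \<in> {1, 2}. \<forall>i \<in> {1..n}. f (r, i) \<in> {-1, 1, 2} \<and>
      dominated (row n f r (i - 1)) (row n f r i) (row n f (3 - r) i) (row n f r (i + 1)))"
proof -
  have defended: "(\<exists>v \<in> pverts (ladder_graph n). ((r, i), v) \<in> parcs (ladder_graph n) \<and> f v = 2) \<longleftrightarrow>
      2 \<in> {row n f r (i - 1), row n f (3 - r) i, row n f r (i + 1)}"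
    if r: "r \<in> {1, 2}" and i: "i \<in> {1..n}" for r i
  proof -
    have "(\<exists>v \<in> pverts (ladder_graph n). ((r, i), v) \<in> parcs (ladder_graph n) \<and> f v = 2) \<longleftrightarrow>
        (\<exists>v \<in> {(r, i - 1), (3 - r, i), (r, i + 1)}. v \<in> pverts (ladder_graph n) \<and> f v = 2)"
      unfolding arc_ladder_graph_iff[OF r i] by blast
    also have "\<dots> \<longleftrightarrow> 2 \<in> {row n f r (i - 1), row n f (3 - r) i, row n f r (i + 1)}"
      using r i by (auto simp: row_def pverts_ladder_graph)
    finally show ?thesis .
  qed
  have "SRDF (ladder_graph n) f \<longleftrightarrow> (\<forall>u \<in> pverts (ladder_graph n). f u \<in> {-1, 1, 2} \<and>
      (\<Sum>v \<in> closed_neighbourhood (ladder_graph n) u. f v) \<ge> 1 \<and>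
      (f u = -1 \<longrightarrow> (\<exists>v \<in> pverts (ladder_graph n). (u, v) \<in> parcs (ladder_graph n) \<and> f v = 2)))"
    unfolding SRDF_def by blast
  also have "\<dots> \<longleftrightarrow> (\<forall>r \<in> {1, 2}. \<forall>i \<in> {1..n}. f (r, i) \<in> {-1, 1, 2} \<and>
      (\<Sum>v \<in> closed_neighbourhood (ladder_graph n) (r, i). f v) \<ge> 1 \<and>
      (f (r, i) = -1 \<longrightarrow>
        (\<exists>v \<in> pverts (ladder_graph n). ((r, i), v) \<in> parcs (ladder_graph n) \<and> f v = 2)))"
    by (subst (1) pverts_ladder_graph) blast
  also have "\<dots> \<longleftrightarrow> (\<forall>r \<in> {1, 2}. \<forall>i \<in> {1..n}. f (r, i) \<in> {-1, 1, 2} \<and>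
      dominated (row n f r (i - 1)) (row n f r i) (row n f (3 - r) i) (row n f r (i + 1)))"
  proof (intro ball_cong refl conj_cong)
    fix r i assume r: "r \<in> {1, 2::nat}" and i: "i \<in> {1..n}"
    have "row n f r i = f (r, i)" using i by (simp add: row_def)
    then show "1 \<le> (\<Sum>v \<in> closed_neighbourhood (ladder_graph n) (r, i). f v) \<and>
        (f (r, i) = -1 \<longrightarrow>
          (\<exists>v \<in> pverts (ladder_graph n). ((r, i), v) \<in> parcs (ladder_graph n) \<and> f v = 2)) \<longleftrightarrow>
        dominated (row n f r (i - 1)) (row n f r i) (row n f (3 - r) i) (row n f r (i + 1))"
      unfolding sum_closed_neighbourhood_ladder_graph[OF r i] defended[OF r i] dominated_def
      by simp
  qed
  finally show ?thesis .
qed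

lemma weight_ladder_graph:
  "weight (ladder_graph n) f = (\<Sum>i = 1..n. row n f 1 i + row n f 2 i)"
proof -
  have "weight (ladder_graph n) f = (\<Sum>r \<in> {1, 2}. \<Sum>i = 1..n. f (r, i))"
    unfolding weight_def pverts_ladder_graph by (simp add: sum.cartesian_product)
  also have "\<dots> = (\<Sum>i = 1..n. f (1, i) + f (2, i))"
    by (simp add: sum.distrib)
  also have "\<dots> = (\<Sum>i = 1..n. row n f 1 i + row n f 2 i)"
    by (rule sum.cong) (auto simp: row_def)
  finally show ?thesis .
qed

section \<open>The lower bound\<close>

text \<open>
  With \<open>(p, p')\<close> and \<open>(c, c')\<close> the columns at positions \<open>k - 1\<close> and \<open>k \<ge> 2\<close>, this is a lower bound for
  \<open>2 w - k\<close>, where \<open>w\<close> is the weight of the first \<open>k\<close> columns. The exact minima of this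
  quantity are slightly larger for some pairs of columns but follow no simple formula.
\<close>

definition potential :: "int \<Rightarrow> int \<Rightarrow> int \<Rightarrow> int \<Rightarrow> int" where
  "potential p p' c c' = c + c' +
    (if c = -1 \<and> c' = -1 then p + p' - 2
     else if c \<noteq> -1 \<and> c' \<noteq> -1 then 1
     else if 2 \<in> {p, p', c, c'} then 3 else 2)"

lemma potential_first:
  assumes "{c, c', q, q'} \<subseteq> {-1, 1, 2}" "dominated 0 c c' q" "dominated 0 c' c q'"
  shows "potential c c' q q' \<le> 2 * (c + c' + q + q') - 2"
  using assms by (auto simp only: insert_subset insert_iff empty_iff simp_thms)
    (simp_all add: dominated_def potential_def)

text \<open>A new column \<open>(q, q')\<close> raises \<open>2 w - k\<close> by
  \<open>2 * (q + q') - 1\<close>. The conditions on the column before it bound the growth of the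
  potential by this amount, by a finite check of all values.\<close>

lemma potential_step:
  assumes "{p, p', c, c', q, q'} \<subseteq> {-1, 1, 2}" "dominated p c c' q" "dominated p' c' c q'"
  shows "potential c c' q q' \<le> potential p p' c c' + 2 * (q + q') - 1"
  using assms by (auto simp only: insert_subset insert_iff empty_iff simp_thms)
    (simp_all add: dominated_def potential_def)

text \<open>A last column \<open>(-1, -1)\<close> would need \<open>p \<ge> 3\<close>. Without a -1,
  \<open>c + c' \<ge> 2\<close> suffices. With exactly one, \<open>c + c' \<ge> 0\<close> and the
  defending 2 is among \<open>p, p', c, c'\<close>, so the summand 3 applies.\<close>

lemma potential_last:
  assumes "{p, p', c, c'} \<subseteq> {-1, 1, 2}" "dominated p c c' 0" "dominated p' c' c 0"
  shows "potential p p' c c' \<ge> 3"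
  using assms by (auto simp only: insert_subset insert_iff empty_iff simp_thms)
    (simp_all add: dominated_def potential_def)

lemma weight_SRDF_ladder_graph_ge:
  assumes n: "n \<ge> 2" and f: "SRDF (ladder_graph n) f"
  shows "2 * weight (ladder_graph n) f \<ge> int n + 3"
proof -
  define a where "a = row n f 1"
  define b where "b = row n f 2"
  have ends: "a 0 = 0" "b 0 = 0" "a (n + 1) = 0" "b (n + 1) = 0"
    by (auto simp: a_def b_def row_def)
  have vals: "a i \<in> {-1, 1, 2}" "b i \<in> {-1, 1, 2}" if "i \<in> {1..n}" for i
    using f that by (auto simp: SRDF_ladder_graph_iff a_def b_def row_def)
  have dom: "dominated (a (i - 1)) (a i) (b i) (a (i + 1))"
    "dominated (b (i - 1)) (b i) (a i) (b (i + 1))" if "i \<in> {1..n}" for i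
    using f that by (auto simp: SRDF_ladder_graph_iff a_def b_def)
  have "potential (a (k - 1)) (b (k - 1)) (a k) (b k) \<le> 2 * (\<Sum>i = 1..k. a i + b i) - int k"
    if "2 \<le> k" "k \<le> n" for k
    using that
  proof (induction k rule: dec_induct)
    case base
    have "(\<Sum>i = 1..2. a i + b i) = a 1 + b 1 + a 2 + b 2"
      by (simp add: numeral_2_eq_2)
    moreover have "potential (a 1) (b 1) (a 2) (b 2) \<le> 2 * (a 1 + b 1 + a 2 + b 2) - 2"
      using vals[of 1] vals[of 2] dom[of 1] n ends
      by (intro potential_first) (auto simp: numeral_2_eq_2)
    ultimately show ?case by simp
  next
    case (step k)
    have k: "k - 1 \<in> {1..n}" "k \<in> {1..n}" "Suc k \<in> {1..n}"
      using step.hyps step.prems by auto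
    have "potential (a k) (b k) (a (Suc k)) (b (Suc k)) \<le>
        potential (a (k - 1)) (b (k - 1)) (a k) (b k) + 2 * (a (Suc k) + b (Suc k)) - 1"
      using vals[OF k(1)] vals[OF k(2)] vals[OF k(3)] dom[OF k(2)]
      by (intro potential_step) (simp_all only: insert_subset empty_subsetI simp_thms Suc_eq_plus1)
    with step show ?case by simp
  qed
  from this[of n] n
  have "potential (a (n - 1)) (b (n - 1)) (a n) (b n) \<le> 2 * weight (ladder_graph n) f - int n"
    by (simp add: weight_ladder_graph a_def b_def)
  moreover have "potential (a (n - 1)) (b (n - 1)) (a n) (b n) \<ge> 3"
    using vals[of "n - 1"] vals[of n] dom[of n] ends n by (intro potential_last) auto
  ultimately show ?thesis by simp
qed

section \<open>An optimal function\<close>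

text \<open>The raised entry of an end column lies in the row where the adjacent column has its 1,
  so the remaining -1 is next to the 2. The residue of \<open>n\<close> modulo 4 selects this row at
  the right end.\<close>

definition optimal_SRDF :: "nat \<Rightarrow> nat \<times> nat \<Rightarrow> int" where
  "optimal_SRDF n = (\<lambda>(r, i).
     (if odd i then -1 else if (r = 1) = (i mod 4 = 0) then 1 else 2) +
     (if r = 2 \<and> i = 1 then 2 else 0) +
     (if i = n \<and> n mod 4 = (if r = 1 then 1 else 3) then 2 else 0))"

lemma row_optimal_SRDF:
  assumes "n \<ge> 2" "r \<in> {1, 2}" "i \<in> {1..n}"
  shows "row n (optimal_SRDF n) r i =
    (if even i then if (r = 1) = (i mod 4 = 0) then 1 else 2
     else if i = 1 then if r = 1 then -1 else 1
     else if i = n then if (r = 1) = (n mod 4 = 1) then 1 else -1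
     else -1)"
proof -
  \<comment> \<open>The last column is raised only for odd \<open>n\<close>, and then in exactly one
    row.\<close>
  have "n mod 4 \<noteq> 1 \<and> n mod 4 \<noteq> 3" if "even n" using that by presburger
  moreover have "n mod 4 = 1 \<or> n mod 4 = 3" if "odd n" using that by presburger
  ultimately show ?thesis
    using assms by (auto simp: row_def optimal_SRDF_def)
qed

lemma SRDF_optimal_SRDF:
  assumes n: "n \<ge> 2"
  shows "SRDF (ladder_graph n) (optimal_SRDF n)"
proof -
  define g where "g = row n (optimal_SRDF n)"
  note g = row_optimal_SRDF[OF n, folded g_def]
  have range: "g r i \<in> {-1, 1, 2}" if "r \<in> {1, 2}" "i \<in> {1..n}" for r i
    using g[OF that] by simp
  have outside: "g r i = 0" if "i \<notin> {1..n}" for r i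
    using that by (auto simp: g_def row_def)
  have lower: "g r i \<ge> -1" if "r \<in> {1, 2}" for r i
    using range[OF that, of i] outside[of i r] by fastforce
  have "dominated (g r (i - 1)) (g r i) (g (3 - r) i) (g r (i + 1))"
    if r: "r \<in> {1, 2}" and i: "i \<in> {1..n}" for r i
  proof -
    have r': "3 - r \<in> {1, 2}" using r by auto
    consider "even i" | "i = 1" | "odd i" "1 < i" "i < n" | "odd n" "i = n" "1 < n"
      using i n by fastforce
    then show ?thesis
    proof cases
      case 1
      \<comment> \<open>The column sum 3 outweighs the two side neighbours, each at least
        -1.\<close>
      then have "g r i + g (3 - r) i = 3" "g r i \<noteq> -1"
        using r i g[OF r i] g[OF r' i] by auto
      then show ?thesis
        using lower[OF r, of "i - 1"] lower[OF r, of "i + 1"] by (simp add: dominated_def)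
    next
      case 2
      then show ?thesis
        using r n g[OF r i] g[OF r' i] g[OF r, of "i + 1"] outside[of 0 r]
        by (auto simp: dominated_def numeral_2_eq_2)
    next
      case 3
      \<comment> \<open>The 2 changes rows from one even column to the next, so each row has a 1 and
        a 2 around column \<open>i\<close>, and the sum is \<open>3 - 2 = 1\<close>.\<close>
      then have "even (i - 1)" "even (i + 1)" "(i - 1) mod 4 = 0 \<longleftrightarrow> (i + 1) mod 4 \<noteq> 0"
        "i - 1 \<in> {1..n}" "i + 1 \<in> {1..n}"
        by (auto, presburger+)
      then have "g r (i - 1) + g r (i + 1) = 3" "2 \<in> {g r (i - 1), g r (i + 1)}"
        using g[OF r, of "i - 1"] g[OF r, of "i + 1"] by (auto split: if_splits)
      moreover have "g r i = -1" "g (3 - r) i = -1"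
        using 3 g[OF r i] g[OF r' i] by simp_all
      ultimately show ?thesis by (auto simp: dominated_def)
    next
      case 4
      then have "even (n - 1)" "(n - 1) mod 4 = 0 \<longleftrightarrow> n mod 4 = 1" "n - 1 \<in> {1..n}"
        by (auto, presburger+)
      then have "g r (n - 1) = (if (r = 1) = (n mod 4 = 1) then 1 else 2)"
        using g[OF r, of "n - 1"] by simp
      moreover have "g r n = (if (r = 1) = (n mod 4 = 1) then 1 else -1)"
        "g (3 - r) n = (if (r = 1) = (n mod 4 = 1) then -1 else 1)" "g r (n + 1) = 0"
        using 4 r g[OF r i] g[OF r' i] outside[of "n + 1" r] by auto
      ultimately show ?thesis using 4 by (auto simp: dominated_def)
    qed
  qed
  moreover have "optimal_SRDF n (r, i) = g r i" if "i \<in> {1..n}" for r i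
    using that by (simp add: g_def row_def)
  ultimately show ?thesis
    using range unfolding SRDF_ladder_graph_iff g_def by simp
qed

lemma weight_optimal_SRDF:
  assumes "n \<ge> 2"
  shows "weight (ladder_graph n) (optimal_SRDF n) = int (n div 2) + 2"
proof -
  \<comment> \<open>Each pair of columns contributes \<open>-2 + 3 = 1\<close>. For odd
    \<open>m\<close> a -2 is left over, which the raise in the last column will cancel.\<close>
  have *: "(\<Sum>i = 1..m. if odd i then -2 else 3) = int (m div 2) - (if odd m then 2 else 0)"
    for m :: nat
    by (induction m) auto
  have "weight (ladder_graph n) (optimal_SRDF n) =
      (\<Sum>i = 1..n. (if odd i then -2 else 3) + (if i = 1 then 2 else 0) +
        (if i = n then if odd n then 2 else 0 else 0))"
    unfolding weight_ladder_graph
  proof (rule sum.cong)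
    fix i assume "i \<in> {1..n}"
    moreover have "odd n \<longleftrightarrow> n mod 4 = 1 \<or> n mod 4 = 3" by presburger
    ultimately show "row n (optimal_SRDF n) 1 i + row n (optimal_SRDF n) 2 i =
        (if odd i then -2 else 3) + (if i = 1 then 2 else 0) +
        (if i = n then if odd n then 2 else 0 else 0)"
      by (auto simp: row_def optimal_SRDF_def)
  qed simp
  also have "\<dots> = int (n div 2) + 2"
    using assms unfolding sum.distrib * by simp
  finally show ?thesis .
qed

theorem theorem1:
  fixes n :: nat
  assumes "n \<ge> 2"
  shows "signed_Roman_domination_number (ladder_graph n) = \<lfloor>(real n + 2) / 2\<rfloor> + 1"
proof -
  have "signed_Roman_domination_number (ladder_graph n) = int (n div 2) + 2"
    unfolding signed_Roman_domination_number_def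
  proof (rule Min_eqI)
    show "finite (weight (ladder_graph n) ` {f. SRDF (ladder_graph n) f})"
      by (rule finite_weights_SRDF[OF pair_graph_ladder_graph])
    show "int (n div 2) + 2 \<in> weight (ladder_graph n) ` {f. SRDF (ladder_graph n) f}"
      using SRDF_optimal_SRDF[OF assms] weight_optimal_SRDF[OF assms]
      by (metis imageI mem_Collect_eq)
  next
    fix w assume "w \<in> weight (ladder_graph n) ` {f. SRDF (ladder_graph n) f}"
    then have "2 * w \<ge> int n + 3"
      using weight_SRDF_ladder_graph_ge[OF assms] by auto
    \<comment> \<open>As \<open>w\<close> is an integer, the bound \<open>(n + 3) / 2\<close> rounds
      up to \<open>n div 2 + 2\<close> for either parity.\<close>
    then show "int (n div 2) + 2 \<le> w" by presburger
  qed
  also have "\<dots> = \<lfloor>(real n + 2) / 2\<rfloor> + 1"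
  proof -
    have "\<lfloor>(real n + 2) / 2\<rfloor> = \<lfloor>real (n + 2) / real 2\<rfloor>" by (simp add: add.commute)
    also have "\<dots> = int ((n + 2) div 2)" by (rule floor_divide_of_nat_eq)
    finally show ?thesis by simp
  qed
  finally show ?thesis .
qed

end
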